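(* For $n\ge1$, let $\bar S_n$ be the mean size of a semantic tree induced by a process tree of size $n$, i.e. the arithmetic mean over all plane rooted trees $T$ of size $n$ of the number of nodes of $\mathrm{Sem}(T)$, and for $0\le i\le n-1$ let $\bar W^i_n$ be the mean, over the same trees, of the number of nodes of $\mathrm{Sem}(T)$ at level $n-i-1$. Then $$\bar S_n=\sum_{i=0}^{n-1}\bar W^i_n\ \sim_{n\to\infty}\ e\,\frac{n!}{2^{n-1}}.$$
   Context: A process tree (syntax tree) is a plane rooted tree, i.e. a rooted tree in which the children of each node are linearly ordered; its size is its number of nodes. The nodes of a given tree are regarded as carrying pairwise distinct names (actions), but trees are enumerated up to isomorphism of plane rooted trees (unlabelled). The root of a tree is at level $0$ and the children of a node at level $j$ are at level $j+1$. For a plane rooted tree $T$ whose root has children $v_1,\dots,v_r$ from left to right, and $1\le i\le r$, the $i$-contraction $T\lhd i$ is the plane tree with root $v_i$ whose root-subtrees are, from left to right, $T(v_1),\dots,T(v_{i-1}),T(v_{i_1}),\dots,T(v_{i_m}),T(v_{i+1}),\dots,T(v_r)$, where $T(v)$ is the subtree of all descendants of $v$ (including $v$) and $v_{i_1},\dots,v_{i_m}$ are the children of $v_i$ in order. The semantic tree $\mathrm{Sem}(T)$ is defined recursively: if $T$ is a single node, $\mathrm{Sem}(T)=T$; if $T$ has root $t$ with $r\ge1$ children, $\mathrm{Sem}(T)$ has root $t$ and root-subtrees $\mathrm{Sem}(T\lhd 1),\dots,\mathrm{Sem}(T\lhd r)$ from left to right. (All leaves of $\mathrm{Sem}(T)$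 are at level $n-1$ if $T$ has size $n$.) *)

theory Defs
  imports Complex_Main "HOL-Library.Landau_Symbols"
begin

text \<open>
  Trees are considered up to isomorphism of plane rooted trees, so nodes carry no labels: a
  tree is the list of its root-subtrees from left to right.
\<close>

datatype plane_tree = Node (subtrees: "plane_tree list")

text \<open>
  The automatically generated \<open>size\<close> of the datatype also counts list constructors; the number of
  nodes is defined separately.
\<close>

primrec num_nodes :: "plane_tree \<Rightarrow> nat" where
  "num_nodes (Node ts) = Suc (sum_list (map num_nodes ts))"

fun nodes_at_level :: "nat \<Rightarrow> plane_tree \<Rightarrow> nat" where
  "nodes_at_level 0 T = 1"
| "nodes_at_level (Suc j) T = sum_list (map (nodes_at_level j) (subtrees T))"

text \<open>
  Children are numbered from 1 on, and \<open>contract T i\<close> is meaningful only for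
  \<open>1 \<le> i \<le> length (subtrees T)\<close>; the list index of the \<open>i\<close>-th child is \<open>i - 1\<close>.
\<close>

definition contract :: "plane_tree \<Rightarrow> nat \<Rightarrow> plane_tree" where
  "contract T i =
     Node (take (i - 1) (subtrees T) @ subtrees (subtrees T ! (i - 1)) @ drop i (subtrees T))"

lemma num_nodes_subtrees: "num_nodes T = Suc (sum_list (map num_nodes (subtrees T)))"
  by (cases T) simp

lemma num_nodes_contract:
  assumes "1 \<le> i" "i \<le> length (subtrees T)"
  shows "num_nodes T = Suc (num_nodes (contract T i))"
proof -
  obtain k where i: "i = Suc k" using assms(1) by (cases i) auto
  have k: "k < length (subtrees T)" using assms(2) i by simp
  have split: "subtrees T = take k (subtrees T) @ subtrees T ! k # drop (Suc k) (subtrees T)"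
    by (rule id_take_nth_drop[OF k])
  have "num_nodes T = Suc (sum_list (map num_nodes
      (take k (subtrees T) @ subtrees T ! k # drop (Suc k) (subtrees T))))"
    by (subst num_nodes_subtrees, subst split) (rule refl)
  also have "\<dots> = Suc (num_nodes (contract T i))"
    by (simp add: contract_def i num_nodes_subtrees[of "subtrees T ! k"])
  finally show ?thesis .
qed

text \<open>A single node has no children, so its semantic tree is again a single node.\<close>

function Sem :: "plane_tree \<Rightarrow> plane_tree" where
  "Sem T = Node (map (\<lambda>i. Sem (contract T i)) [1..<Suc (length (subtrees T))])"
  by auto
termination
proof (relation "measure num_nodes")
  fix T i assume "i \<in> set [1..<Suc (length (subtrees T))]"
  then have "1 \<le> i" "i \<le> length (subtrees T)" by auto
  from num_nodes_contract[OF this] show "(contract T i, T) \<in> measure num_nodes" by simp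
qed simp

declare Sem.simps [simp del]

definition plane_trees :: "nat \<Rightarrow> plane_tree set" where
  "plane_trees n = {T. num_nodes T = n}"

lemma num_nodes_pos: "1 \<le> num_nodes T"
  by (cases T) simp

lemma finite_num_nodes_le: "finite {T. num_nodes T \<le> n}"
proof (induction n)
  case 0
  have "{T. num_nodes T \<le> 0} = {}" using num_nodes_pos by (auto simp: not_le less_eq_Suc_le)
  then show ?case by (simp only: finite.emptyI)
next
  case (Suc n)
  have len: "length ts \<le> sum_list (map num_nodes ts)" for ts
  proof (induction ts)
    case (Cons t ts) then show ?case using num_nodes_pos[of t] by simp
  qed simp
  have "{T. num_nodes T \<le> Suc n} \<subseteq>
      Node ` {ts. set ts \<subseteq> {T. num_nodes T \<le> n} \<and> length ts \<le> n}"
  proof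
    fix T assume "T \<in> {T. num_nodes T \<le> Suc n}"
    then obtain ts where T: "T = Node ts" and s: "sum_list (map num_nodes ts) \<le> n"
      by (cases T) auto
    have "num_nodes t \<le> n" if "t \<in> set ts" for t
      using member_le_sum_list[of "num_nodes t" "map num_nodes ts"] that s by auto
    then show "T \<in> Node ` {ts. set ts \<subseteq> {T. num_nodes T \<le> n} \<and> length ts \<le> n}"
      using T s len[of ts] by auto
  qed
  then show ?case by (rule finite_subset) (intro finite_imageI finite_lists_length_le Suc.IH)
qed

lemma finite_plane_trees: "finite (plane_trees n)"
  unfolding plane_trees_def by (rule finite_subset[OF _ finite_num_nodes_le[of n]]) auto

lemma plane_trees_nonempty: "1 \<le> n \<Longrightarrow> plane_trees n \<noteq> {}"
proof -
  assume "1 \<le> n"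
  then have "Node (replicate (n - 1) (Node [])) \<in> plane_trees n"
    by (simp add: plane_trees_def sum_list_replicate)
  then show ?thesis by blast
qed

definition mean_Sem_size :: "nat \<Rightarrow> real" where
  "mean_Sem_size n =
     (\<Sum>T\<in>plane_trees n. real (num_nodes (Sem T))) / real (card (plane_trees n))"

text \<open>
  Levels are indexed from the bottom: if \<open>T\<close> has size \<open>n\<close>, all leaves of \<open>Sem T\<close> are at level
  \<open>n - 1\<close>, which corresponds to \<open>i = 0\<close>. Only \<open>i < n\<close> is meaningful.
\<close>

definition mean_Sem_level :: "nat \<Rightarrow> nat \<Rightarrow> real" where
  "mean_Sem_level n i =
     (\<Sum>T\<in>plane_trees n. real (nodes_at_level (n - i - 1) (Sem T))) / real (card (plane_trees n))"

end

theory Submission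
  imports Defs "HOL-Analysis.Uniform_Limit" "HOL-Real_Asymp.Real_Asymp"
begin

text \<open>
  A child contraction is undone by gathering a contiguous block of root-subtrees under a new node.
  If the root has \<open>d\<close> children, there are \<open>e + 1\<close> ways to do this that leave \<open>e + 1\<close> children
  (\<open>e \<le> d\<close>). Hence the weights \<open>(d + s) choose s\<close> are mapped to each other by summing over
  contractions: level \<open>j + 1\<close> at size \<open>n + 1\<close> with parameter \<open>s\<close> is \<open>s + 1\<close> times level \<open>j\<close> at size
  \<open>n\<close> with parameter \<open>s + 2\<close>. Iterating down to level 0 gives the odd factors \<open>1 * 3 * \<dots> * (2j - 1)\<close>
  and a weighted count of plane forests, which is a ballot number. With \<open>n = N + 1\<close>, the mean
  at level \<open>n - i - 1\<close> divided by \<open>n! / 2 ^ (n - 1)\<close> is therefore an explicit product of \<open>i\<close> factors.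
  It tends to \<open>1 / i!\<close> for fixed \<open>i\<close> and is dominated by a geometric series, so Tannery's theorem
  yields the limit \<open>e\<close>.
\<close>

section \<open>Plane forests and ballot numbers\<close>

definition forests :: "nat \<Rightarrow> plane_tree list set" where
  "forests m = {f. sum_list (map num_nodes f) = m}"

lemma bij_betw_Node_forests: "bij_betw Node (forests m) (plane_trees (Suc m))"
  by (rule bij_betw_byWitness[where f' = subtrees])
     (auto simp: forests_def plane_trees_def num_nodes_subtrees[of "_ :: plane_tree"])

lemma sum_plane_trees_Suc:
  fixes g :: "plane_tree \<Rightarrow> 'a::comm_monoid_add"
  shows "sum g (plane_trees (Suc m)) = (\<Sum>f\<in>forests m. g (Node f))"
  using sum.reindex_bij_betw[OF bij_betw_Node_forests, of g m] by simp

lemma finite_forests: "finite (forests m)"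
  using bij_betw_finite[OF bij_betw_Node_forests] finite_plane_trees by blast

lemma forests_0: "forests 0 = {[]}"
proof -
  have "f = []" if "sum_list (map num_nodes f) = 0" for f
    using that num_nodes_pos[of "hd f"] by (cases f) auto
  then show ?thesis by (auto simp: forests_def)
qed

lemma sum_list_take_drop:
  fixes xs :: "nat list"
  shows "sum_list (take k xs) + sum_list (drop k xs) = sum_list xs"
  by (metis append_take_drop_id sum_list_append)

text \<open>The root of the first tree is deleted and its \<open>c\<close> children become the first
  trees of a forest with one node fewer; knowing \<open>c\<close> suffices to put the root
  back.\<close>

lemma sum_forests_Suc:
  fixes g :: "plane_tree list \<Rightarrow> 'a::comm_monoid_add"
  shows "sum g (forests (Suc m)) =
    (\<Sum>f\<in>forests m. \<Sum>c\<le>length f. g (Node (take c f) # drop c f))"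
proof -
  have "sum g (forests (Suc m)) =
      (\<Sum>(f, c)\<in>(SIGMA f:forests m. {..length f}). g (Node (take c f) # drop c f))"
  proof (rule sum.reindex_bij_witness[where
        i = "\<lambda>(f, c). Node (take c f) # drop c f" and
        j = "\<lambda>f. (subtrees (hd f) @ tl f, length (subtrees (hd f)))"], goal_cases)
    case (1 f)
    then show ?case by (cases f) (auto simp: forests_def)
  next
    case (2 f)
    then show ?case
      by (cases f) (auto simp: forests_def num_nodes_subtrees[of "_ :: plane_tree"])
  next
    case (3 p)
    then show ?case by auto
  next
    case (4 p)
    then show ?case
      by (auto simp: forests_def sum_list_take_drop simp flip: take_map drop_map)
  next
    case (5 f)
    then show ?case by (cases f) (auto simp: forests_def)
  qed
  then show ?thesis by (simp add: sum.Sigma finite_forests)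
qed

text \<open>The weight counts the ways to cut a forest into \<open>s + 1\<close> consecutive,
  possibly empty pieces. The sum is thus the coefficient of z^m in C(z)^(s+1), with C the Catalan
  series.\<close>

definition weighted_forests :: "nat \<Rightarrow> nat \<Rightarrow> nat" where
  "weighted_forests m s = (\<Sum>f\<in>forests m. (length f + s) choose s)"

lemma weighted_forests_0: "weighted_forests 0 s = 1"
  by (simp add: weighted_forests_def forests_0)

lemma weighted_forests_Suc_0: "weighted_forests (Suc m) 0 = weighted_forests m 1"
  using sum_forests_Suc[of "\<lambda>_. 1 :: nat" m] by (simp add: weighted_forests_def)

text \<open>In terms of the Catalan series this is C^(s+2) = C^(s+1) + z C^(s+3), from C = 1 + z
  C^2. The proof splits off the first root, applies Pascal's rule to each weight and sums one of the
  two parts by the hockey-stick identity.\<close>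

lemma weighted_forests_Suc_Suc:
  "weighted_forests (Suc m) (Suc s) = weighted_forests (Suc m) s + weighted_forests m (s + 2)"
proof -
  have "(\<Sum>c\<le>d. (Suc (d - c) + Suc s) choose Suc s) =
      (\<Sum>c\<le>d. (Suc (d - c) + s) choose s) + ((d + (s + 2)) choose (s + 2))" for d
  proof -
    have "(\<Sum>c\<le>d. (Suc (d - c) + Suc s) choose Suc s) =
        (\<Sum>c\<le>d. (Suc (d - c) + s) choose s) + (\<Sum>c\<le>d. (Suc s + (d - c)) choose Suc s)"
      unfolding sum.distrib[symmetric] by (intro sum.cong) (auto simp: add_ac)
    also have "(\<Sum>c\<le>d. (Suc s + (d - c)) choose Suc s) = (\<Sum>c\<le>d. (Suc s + c) choose Suc s)"
      by (rule sum.reindex_bij_witness[where i = "\<lambda>c. d - c" and j = "\<lambda>c. d - c"]) auto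
    also have "\<dots> = (d + (s + 2)) choose (s + 2)"
      by (subst choose_rising_sum) (simp add: add_ac)
    finally show ?thesis .
  qed
  then show ?thesis
    by (simp add: weighted_forests_def sum_forests_Suc sum.distrib del: binomial_Suc_Suc)
qed

text \<open>The ballot number (s+1)/(s+2m+1) * ((s+2m+1) choose m), cleared of denominators to stay
  in \<open>nat\<close>. An outer induction on \<open>m\<close> and an inner one on \<open>s\<close>
  follow the recurrences.\<close>

lemma weighted_forests_closed_form:
  "weighted_forests m s * (fact m * fact (s + m + 1)) = (s + 1) * fact (s + 2 * m)"
proof (induction m arbitrary: s)
  case 0
  then show ?case by (simp add: weighted_forests_0)
next
  case (Suc m)
  note outer = Suc
  \<comment> \<open>\<open>scale\<close> and \<open>scale'\<close> multiply an instance of the claim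
    by the factor \<open>c\<close> by which the first or the second factorial has to grow.\<close>
  have scale: "X * (c * A * B) = c * Y" if "X * (A * B) = Y" for X A B Y c :: nat
    using that[symmetric] by (simp add: mult_ac)
  have scale': "X * (A * (c * B)) = c * Y" if "X * (A * B) = Y" for X A B Y c :: nat
    using that[symmetric] by (simp add: mult_ac)
  have fact_m: "(fact (Suc m) :: nat) = (m + 1) * fact m"
    by simp
  show ?case
  proof (induction s)
    case 0
    have "fact (2 * Suc m) = (m + 1) * (2 * (fact (2 * m + 1) :: nat))"
      using fact_Suc[of "2 * m + 1", where ?'a = nat] by (simp add: distrib_right del: fact_Suc)
    moreover have "weighted_forests m 1 * (fact (Suc m) * fact (1 + m + 1)) =
        (m + 1) * ((1 + 1) * fact (1 + 2 * m))"
      unfolding fact_m by (rule scale[OF outer])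
    ultimately show ?case
      by (simp add: weighted_forests_Suc_0 del: fact_Suc mult_Suc)
  next
    case (Suc s)
    have "(fact (Suc s + Suc m + 1) :: nat) = (s + m + 3) * fact (s + Suc m + 1)"
      using fact_Suc[of "s + Suc m + 1", where ?'a = nat]
      by (simp add: numeral_3_eq_3 del: fact_Suc mult_Suc)
    then have a: "weighted_forests (Suc m) s * (fact (Suc m) * fact (Suc s + Suc m + 1)) =
        (s + m + 3) * ((s + 1) * fact (s + 2 * m + 2))"
      using scale'[OF Suc.IH, of "s + m + 3"]
      by (simp add: add_ac del: fact_Suc mult_Suc)
    have "weighted_forests m (s + 2) * (fact (Suc m) * fact (s + 2 + m + 1)) =
        (m + 1) * ((s + 2 + 1) * fact (s + 2 + 2 * m))"
      unfolding fact_m by (rule scale[OF outer])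
    then have b: "weighted_forests m (s + 2) * (fact (Suc m) * fact (Suc s + Suc m + 1)) =
        (m + 1) * ((s + 3) * fact (s + 2 * m + 2))"
      by (simp add: numeral_3_eq_3 del: fact_Suc mult_Suc)
    let ?F = "fact (s + 2 * m + 2) :: nat"
    have f: "fact (Suc s + 2 * Suc m) = (s + 2 * m + 3) * ?F"
      using fact_Suc[of "s + 2 * m + 2", where ?'a = nat]
      by (simp add: numeral_3_eq_3 del: fact_Suc mult_Suc)
    have "weighted_forests (Suc m) (Suc s) * (fact (Suc m) * fact (Suc s + Suc m + 1)) =
        (s + m + 3) * ((s + 1) * ?F) + (m + 1) * ((s + 3) * ?F)"
      by (simp only: weighted_forests_Suc_Suc distrib_right[of "weighted_forests _ _"] a b)
    also have "\<dots> = ((s + m + 3) * (s + 1) + (m + 1) * (s + 3)) * ?F"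
      by (simp only: distrib_right[of "_ * _"] mult.assoc)
    also have "(s + m + 3) * (s + 1) + (m + 1) * (s + 3) = (s + 2) * (s + 2 * m + 3)"
      by (simp add: algebra_simps)
    also have "\<dots> * ?F = (Suc s + 1) * fact (Suc s + 2 * Suc m)"
      unfolding f by (simp only: mult.assoc) simp
    finally show ?case .
  qed
qed

section \<open>Levels of semantic trees\<close>

lemma nodes_at_level_Suc_Sem:
  "nodes_at_level (Suc j) (Sem T) =
    (\<Sum>i=1..length (subtrees T). nodes_at_level j (Sem (contract T i)))"
  by (subst Sem.simps)
     (simp add: interv_sum_list_conv_sum_set_nat o_def atLeastLessThanSuc_atLeastAtMost
       del: upt_Suc)

lemma num_nodes_Sem_rec:
  "num_nodes (Sem T) = Suc (\<Sum>i=1..length (subtrees T). num_nodes (Sem (contract T i)))"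
  by (subst Sem.simps)
     (simp add: interv_sum_list_conv_sum_set_nat o_def atLeastLessThanSuc_atLeastAtMost
       del: upt_Suc)

text \<open>Each contraction lowers the size by exactly one, so no level of \<open>Sem T\<close>
  lies below \<open>num_nodes T - 1\<close>.\<close>

lemma num_nodes_Sem: "num_nodes (Sem T) = (\<Sum>j<num_nodes T. nodes_at_level j (Sem T))"
proof (induction "num_nodes T" arbitrary: T)
  case 0
  then show ?case using num_nodes_pos[of T] by simp
next
  case (Suc n)
  have "num_nodes (Sem T) =
      Suc (\<Sum>i=1..length (subtrees T). \<Sum>j<n. nodes_at_level j (Sem (contract T i)))"
    unfolding num_nodes_Sem_rec[of T]
  proof (intro arg_cong[of _ _ Suc] sum.cong refl)
    fix i assume "i \<in> {1..length (subtrees T)}"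
    then have "num_nodes T = Suc (num_nodes (contract T i))"
      using num_nodes_contract by simp
    with Suc show "num_nodes (Sem (contract T i)) =
        (\<Sum>j<n. nodes_at_level j (Sem (contract T i)))" by simp
  qed
  also have "\<dots> = Suc (\<Sum>j<n. nodes_at_level (Suc j) (Sem T))"
    by (subst sum.swap) (simp only: nodes_at_level_Suc_Sem)
  also have "\<dots> = (\<Sum>j<num_nodes T. nodes_at_level j (Sem T))"
    unfolding Suc(2)[symmetric] by (subst sum.lessThan_Suc_shift) simp
  finally show ?case .
qed

section \<open>Contractions and their inverses\<close>

lemma contract_append:
  "contract (Node (xs @ Node ts # ys)) (Suc (length xs)) = Node (xs @ ts @ ys)"
  by (simp add: contract_def)

lemma child_decomposition:
  assumes "i \<in> {1..length (subtrees T)}"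
  obtains xs ts ys where "T = Node (xs @ Node ts # ys)" "i = Suc (length xs)"
proof
  let ?f = "subtrees T" and ?k = "i - 1"
  have k: "?k < length ?f" using assms by auto
  show "T = Node (take ?k ?f @ Node (subtrees (?f ! ?k)) # drop (Suc ?k) ?f)"
    using id_take_nth_drop[OF k] by (cases T) simp
  show "i = Suc (length (take ?k ?f))" using assms k by auto
qed

text \<open>
  The inverse of a contraction: the block starting at position \<open>a\<close> that is gathered under a new node
  is such that \<open>e\<close> root-subtrees remain outside it.
\<close>

definition expand :: "plane_tree \<Rightarrow> nat \<Rightarrow> nat \<Rightarrow> plane_tree" where
  "expand T e a = (let f = subtrees T; c = length f - e
     in Node (take a f @ Node (take c (drop a f)) # drop (a + c) f))"

lemma expand_append:
  "expand (Node (xs @ ts @ ys)) (length xs + length ys) (length xs) = Node (xs @ Node ts # ys)"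
  by (simp add: expand_def)

lemma expansion_decomposition:
  assumes "e \<le> length (subtrees T)" "a \<le> e"
  obtains xs ts ys
    where "T = Node (xs @ ts @ ys)" "e = length xs + length ys" "a = length xs"
proof
  let ?f = "subtrees T" and ?c = "length (subtrees T) - e"
  show "T = Node (take a ?f @ take ?c (drop a ?f) @ drop (a + ?c) ?f)"
    by (cases T) (metis append_take_drop_id drop_drop add.commute plane_tree.sel)
  show "e = length (take a ?f) + length (drop (a + ?c) ?f)" "a = length (take a ?f)"
    using assms by auto
qed

text \<open>Double counting: a tree with a child to contract amounts to the contracted tree, the
  number \<open>e\<close> of root-subtrees outside the gathered block, and the start
  \<open>a \<le> e\<close> of the block. The factor \<open>Suc e\<close> counts the choices of
  \<open>a\<close>.\<close>

lemma sum_contract: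
  fixes h :: "nat \<Rightarrow> plane_tree \<Rightarrow> nat"
  shows "(\<Sum>T\<in>plane_trees (Suc n). \<Sum>i=1..length (subtrees T).
      h (length (subtrees T)) (contract T i)) =
    (\<Sum>T\<in>plane_trees n. \<Sum>e\<le>length (subtrees T). Suc e * h (Suc e) T)"
proof -
  let ?A = "SIGMA T:plane_trees (Suc n). {1..length (subtrees T)}"
  let ?B = "SIGMA T:plane_trees n. SIGMA e:{..length (subtrees T)}. {..e}"
  have "(\<Sum>(T, i)\<in>?A. h (length (subtrees T)) (contract T i)) = (\<Sum>(T, e, a)\<in>?B. h (Suc e) T)"
  proof (rule sum.reindex_bij_witness[where
        i = "\<lambda>(T, e, a). (expand T e a, Suc a)" and
        j = "\<lambda>(T, i). (contract T i, length (subtrees T) - 1, i - 1)"], goal_cases)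
    case (1 p)
    then obtain T i where "p = (T, i)" "i \<in> {1..length (subtrees T)}" by auto
    then show ?case
      by (elim child_decomposition) (simp add: contract_append expand_append)
  next
    case (2 p)
    then obtain T i where "p = (T, i)" "i \<in> {1..length (subtrees T)}" "T \<in> plane_trees (Suc n)"
      by auto
    then show ?case
      by (elim child_decomposition) (simp add: contract_append plane_trees_def)
  next
    case (3 p)
    then obtain T e a where p: "p = (T, e, a)" "e \<le> length (subtrees T)" "a \<le> e" by auto
    from p(2,3) obtain xs ts ys
      where "T = Node (xs @ ts @ ys)" "e = length xs + length ys" "a = length xs"
      by (rule expansion_decomposition)
    with p(1) show ?case by (simp add: contract_append expand_append)
  next
    case (4 p)
    then obtain T e a where p: "p = (T, e, a)" "e \<le> length (subtrees T)" "a \<le> e"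
      "T \<in> plane_trees n" by auto
    from p(2,3) obtain xs ts ys
      where "T = Node (xs @ ts @ ys)" "e = length xs + length ys" "a = length xs"
      by (rule expansion_decomposition)
    with p(1,4) show ?case by (simp add: expand_append plane_trees_def)
  next
    case (5 p)
    then obtain T i where p: "p = (T, i)" "1 \<le> i" "i \<le> length (subtrees T)" by auto
    \<comment> \<open>There is at least one child, so the truncated subtraction loses
      nothing.\<close>
    then have "Suc (length (subtrees T) - 1) = length (subtrees T)" by simp
    then show ?case by (simp add: p(1) del: Suc_pred)
  qed
  then show ?thesis by (simp add: sum.Sigma[symmetric] finite_plane_trees)
qed

section \<open>Weighted level sums\<close>

text \<open>For \<open>s = 0\<close> this is the numerator of the mean; larger \<open>s\<close> is
  needed because each descent by one level raises \<open>s\<close> by two.\<close>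

definition weighted_level :: "nat \<Rightarrow> nat \<Rightarrow> nat \<Rightarrow> nat" where
  "weighted_level n s j =
    (\<Sum>T\<in>plane_trees n. ((length (subtrees T) + s) choose s) * nodes_at_level j (Sem T))"

lemma weighted_level_Suc_Suc:
  "weighted_level (Suc n) s (Suc j) = Suc s * weighted_level n (s + 2) j"
proof -
  have binom: "(\<Sum>e\<le>d. Suc e * ((Suc e + s) choose s)) =
      Suc s * ((d + (s + 2)) choose (s + 2))" for d
  proof -
    \<comment> \<open>Absorption turns the factor \<open>Suc e\<close> into the constant
      \<open>Suc s\<close> and leaves a hockey-stick sum over \<open>e\<close>.\<close>
    have "Suc e * ((Suc e + s) choose s) = Suc s * ((Suc s + e) choose Suc s)" for e
      using Suc_times_binomial_add[of s e] by (simp add: add_ac del: binomial_Suc_Suc)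
    then have "(\<Sum>e\<le>d. Suc e * ((Suc e + s) choose s)) =
        Suc s * (\<Sum>e\<le>d. (Suc s + e) choose Suc s)"
      by (simp only: sum_distrib_left)
    also have "(\<Sum>e\<le>d. (Suc s + e) choose Suc s) = (d + (s + 2)) choose (s + 2)"
      by (subst choose_rising_sum) (simp add: add_ac)
    finally show ?thesis .
  qed
  have "weighted_level (Suc n) s (Suc j) =
      (\<Sum>T\<in>plane_trees (Suc n). \<Sum>i=1..length (subtrees T).
        ((length (subtrees T) + s) choose s) * nodes_at_level j (Sem (contract T i)))"
    by (simp only: weighted_level_def nodes_at_level_Suc_Sem sum_distrib_left)
  also have "\<dots> = (\<Sum>T\<in>plane_trees n.
      (\<Sum>e\<le>length (subtrees T). Suc e * ((Suc e + s) choose s)) * nodes_at_level j (Sem T))"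
    by (subst sum_contract) (simp only: sum_distrib_right mult.assoc)
  also have "\<dots> = Suc s * weighted_level n (s + 2) j"
    by (simp only: binom weighted_level_def sum_distrib_left mult.assoc)
  finally show ?thesis .
qed

lemma weighted_level_0: "weighted_level (Suc m) s 0 = weighted_forests m s"
  by (simp add: weighted_level_def weighted_forests_def sum_plane_trees_Suc)

lemma weighted_level_eq:
  "weighted_level (Suc (m + j)) s j = (\<Prod>k<j. s + 2 * k + 1) * weighted_forests m (s + 2 * j)"
proof (induction j arbitrary: s)
  case 0
  then show ?case by (simp add: weighted_level_0)
next
  case (Suc j)
  show ?case
    using Suc[of "s + 2"] unfolding prod.lessThan_Suc_shift
    by (simp add: weighted_level_Suc_Suc mult.assoc del: mult_Suc)
qed

text \<open>For \<open>s = 0\<close> the ballot number is the Catalan number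
  (2m)!/(m!(m+1)!).\<close>

lemma card_plane_trees: "card (plane_trees (Suc m)) = weighted_forests m 0"
  using sum_plane_trees_Suc[of "\<lambda>_. 1 :: nat" m] by (simp add: weighted_forests_def)

lemma mean_Sem_level_eq:
  assumes "i \<le> N"
  shows "mean_Sem_level (Suc N) i =
    real ((\<Prod>k<N-i. 2 * k + 1) * weighted_forests i (2 * (N - i))) / real (weighted_forests N 0)"
  using weighted_level_eq[of i "N - i" 0] assms
  by (simp add: mean_Sem_level_def card_plane_trees weighted_level_def
      flip: of_nat_sum of_nat_prod del: of_nat_mult)

section \<open>The means as explicit products\<close>

lemma weighted_forests_real:
  "real (weighted_forests m s) = (s + 1) * fact (s + 2 * m) / (fact m * fact (s + m + 1))"
  using arg_cong[OF weighted_forests_closed_form[of m s], of real]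
  by (simp add: field_simps del: fact_Suc)

text \<open>The product is the double factorial (2N-1)!!, and 2^N * N! supplies the even factors of
  (2N)!.\<close>

lemma prod_odd: "(\<Prod>k<N. 1 + 2 * real k) * (2 ^ N * fact N) = fact (2 * N)"
proof (induction N)
  case (Suc N)
  have "(\<Prod>k<Suc N. 1 + 2 * real k) * (2 ^ Suc N * fact (Suc N)) =
     ((\<Prod>k<N. 1 + 2 * real k) * (2 ^ N * fact N)) * ((2 * N + 1) * (2 * N + 2))"
    by (simp add: algebra_simps)
  also have "\<dots> = fact (2 * Suc N)"
    unfolding Suc by (simp add: algebra_simps)
  finally show ?case .
qed simp

text \<open>For \<open>j < N\<close> the factor with index \<open>j\<close> is the quotient of the
  means for \<open>j + 1\<close> and \<open>j\<close>.\<close>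

definition level_ratio :: "nat \<Rightarrow> nat \<Rightarrow> real" where
  "level_ratio N i = (\<Prod>j<i. (2 * real N + 1 - real j) / ((real j + 1) * (2 * real N + 1 - 2 * real j)))"

lemma mean_Sem_level_ratio:
  assumes "i \<le> N"
  shows "mean_Sem_level (Suc N) i = level_ratio N i * (fact (Suc N) / 2 ^ N)"
  using assms
proof (induction i)
  case 0
  \<comment> \<open>Here (2N-1)!! divided by the Catalan number is exactly (N+1)!/2^N.\<close>
  have "mean_Sem_level (Suc N) 0 = (\<Prod>k<N. 1 + 2 * real k) / real (weighted_forests N 0)"
    by (simp add: mean_Sem_level_eq weighted_forests_0)
  also have "(\<Prod>k<N. 1 + 2 * real k) = fact (2 * N) / (2 ^ N * fact N)"
    using prod_odd[of N] by (simp add: field_simps)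
  finally show ?case
    by (simp add: weighted_forests_real level_ratio_def field_simps del: fact_Suc)
next
  case (Suc i)
  define j where "j = N - Suc i"
  have N: "N = Suc (i + j)" using Suc.prems by (simp add: j_def)
  define P where "P = (\<Prod>k<j. 1 + 2 * real k)"
  \<comment> \<open>\<open>X\<close> is the part shared by the ballot numbers at
    \<open>Suc i\<close> and \<open>i\<close>; it cancels in the quotient of the means.\<close>
  define X :: real where "X = fact (2 * N) / (fact i * fact (2 * j + i + 2))"
  have idx: "N - Suc i = j" "N - i = Suc j" using N by auto
  have P: "(\<Prod>k<Suc j. 1 + 2 * real k) = P * (1 + 2 * real j)" by (simp add: P_def)
  have "real (weighted_forests (Suc i) (2 * j)) =
      (1 + 2 * real j) * fact (2 * N) / ((1 + real i) * fact i * fact (2 * j + i + 2))"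
    by (simp add: weighted_forests_real N fact_Suc[of i] add_ac del: fact_Suc)
  then have W1: "real (weighted_forests (Suc i) (2 * j)) = X * (1 + 2 * real j) / (1 + real i)"
    by (simp add: X_def mult_ac del: fact_Suc)
  have "real (weighted_forests i (2 * Suc j)) =
      (3 + 2 * real j) * fact (2 * N) /
        (fact i * ((3 + 2 * real j + real i) * fact (2 * j + i + 2)))"
    using fact_Suc[of "2 * j + i + 2", where ?'a = real]
    by (simp add: weighted_forests_real N add_ac numeral_3_eq_3 del: fact_Suc)
  then have W2: "real (weighted_forests i (2 * Suc j)) =
      X * (3 + 2 * real j) / (3 + 2 * real j + real i)"
    by (simp add: X_def mult_ac del: fact_Suc)
  define D where "D = real (weighted_forests N 0)"
  have L1: "mean_Sem_level (Suc N) (Suc i) = P * (X * (1 + 2 * real j) / (1 + real i)) / D"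
    by (subst mean_Sem_level_eq[OF Suc.prems])
       (simp only: idx of_nat_mult W1 D_def P_def of_nat_prod of_nat_add of_nat_numeral of_nat_1 add_ac)
  have L2: "mean_Sem_level (Suc N) i =
      P * (1 + 2 * real j) * (X * (3 + 2 * real j) / (3 + 2 * real j + real i)) / D"
    using Suc.prems
    by (subst mean_Sem_level_eq) (simp, simp only: idx of_nat_mult W2 D_def P[symmetric]
        of_nat_prod of_nat_add of_nat_numeral of_nat_1 add_ac)
  have "mean_Sem_level (Suc N) (Suc i) = mean_Sem_level (Suc N) i *
      ((3 + 2 * real j + real i) / ((1 + real i) * (3 + 2 * real j)))"
  proof -
    have "3 + 2 * real j \<noteq> 0" "3 + 2 * real j + real i \<noteq> 0"
      by (simp_all add: add_nonneg_eq_0_iff)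
    then show ?thesis unfolding L1 L2 by (simp add: mult_ac)
  qed
  also have "(3 + 2 * real j + real i) / ((1 + real i) * (3 + 2 * real j)) =
      (2 * real N + 1 - i) / ((i + 1) * (2 * real N + 1 - 2 * i))"
    by (simp add: N algebra_simps)
  also have "mean_Sem_level (Suc N) i * \<dots> = level_ratio N (Suc i) * (fact (Suc N) / 2 ^ N)"
    using Suc by (simp add: level_ratio_def add.commute mult_ac del: fact_Suc)
  finally show ?case .
qed

section \<open>Domination and the limit\<close>

lemma level_ratio_nonneg: "i \<le> N \<Longrightarrow> 0 \<le> level_ratio N i"
  unfolding level_ratio_def by (intro prod_nonneg ballI divide_nonneg_nonneg mult_nonneg_nonneg) auto

text \<open>The factor with \<open>j = 0\<close> equals 1 and every later one is at most 2/3, whence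
  the prefactor 3/2. The value 2/3 is attained for \<open>N = 2\<close>,
  \<open>j = 1\<close>.\<close>

lemma level_ratio_le:
  assumes "i \<le> N"
  shows "level_ratio N i \<le> 3 / 2 * (2 / 3) ^ i"
  using assms
proof (induction i)
  case 0
  then show ?case by (simp add: level_ratio_def)
next
  case (Suc i)
  show ?case
  proof (cases "i = 0")
    case True
    then show ?thesis by (simp add: level_ratio_def)
  next
    case False
    have "(2 * real N + 1 - i) / ((i + 1) * (2 * real N + 1 - 2 * i)) \<le> 2 / 3"
    proof -
      define m where "m = 2 * real N + 1 - 2 * i"
      have m: "m \<ge> 3" using Suc.prems by (simp add: m_def)
      have i: "real i \<ge> 1" using False by simp
      \<comment> \<open>The difference of the two sides of the next inequality, regrouped into
        nonnegative terms.\<close>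
      have "0 \<le> (real i - 1) * (2 * m - 3) + (m - 3)"
        using m i by (intro add_nonneg_nonneg mult_nonneg_nonneg) auto
      then have "3 * (m + i) \<le> 2 * ((i + 1) * m)" by (simp add: algebra_simps)
      moreover have "2 * real N + 1 - i = m + i" by (simp add: m_def)
      ultimately show ?thesis
        using m unfolding m_def[symmetric] by (simp add: divide_simps)
    qed
    then have "level_ratio N i * ((2 * real N + 1 - i) / ((i + 1) * (2 * real N + 1 - 2 * i))) \<le>
        (3 / 2 * (2 / 3) ^ i) * (2 / 3)"
      using Suc by (intro mult_mono) (auto intro!: divide_nonneg_nonneg)
    then show ?thesis by (simp add: level_ratio_def add.commute)
  qed
qed

lemma level_ratio_tendsto: "(\<lambda>N. level_ratio N i) \<longlonglongrightarrow> 1 / fact i"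
proof -
  have "(\<lambda>N. (2 * real N + 1 - real j) / ((real j + 1) * (2 * real N + 1 - 2 * real j))) \<longlonglongrightarrow> 1 / (real j + 1)" for j
    by (real_asymp simp: field_simps)
  then have "(\<lambda>N. level_ratio N i) \<longlonglongrightarrow> (\<Prod>j<i. 1 / (real j + 1))"
    unfolding level_ratio_def by (intro tendsto_prod) auto
  moreover have "(\<Prod>j<i. 1 / (real j + 1)) = 1 / fact i"
    by (induction i) (auto simp: add.commute)
  ultimately show ?thesis by simp
qed

lemma mean_Sem_size_eq: "mean_Sem_size (Suc N) = (\<Sum>i\<le>N. mean_Sem_level (Suc N) i)"
proof -
  have "real (num_nodes (Sem T)) = (\<Sum>i\<le>N. real (nodes_at_level (Suc N - i - 1) (Sem T)))"
    if "T \<in> plane_trees (Suc N)" for T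
  proof -
    have "num_nodes (Sem T) = (\<Sum>j\<le>N. nodes_at_level j (Sem T))"
      using that num_nodes_Sem[of T] by (simp add: plane_trees_def lessThan_Suc_atMost)
    also have "\<dots> = (\<Sum>i\<le>N. nodes_at_level (N - i) (Sem T))"
      by (rule sum.reindex_bij_witness[where i = "\<lambda>i. N - i" and j = "\<lambda>i. N - i"]) auto
    finally show ?thesis by simp
  qed
  then have "(\<Sum>T\<in>plane_trees (Suc N). real (num_nodes (Sem T))) =
      (\<Sum>i\<le>N. \<Sum>T\<in>plane_trees (Suc N). real (nodes_at_level (Suc N - i - 1) (Sem T)))"
    by (subst sum.swap) simp
  then show ?thesis
    by (simp only: mean_Sem_size_def mean_Sem_level_def sum_divide_distrib)
qed

lemma mean_Sem_size_normalised_tendsto: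
  "(\<lambda>N. mean_Sem_size (Suc N) / (fact (Suc N) / 2 ^ N)) \<longlonglongrightarrow> exp 1"
proof -
  \<comment> \<open>The cutoff turns the finite sum into a series and keeps only the indices for
    which \<open>level_ratio_le\<close> gives the bound; for fixed \<open>i\<close> it has no effect
    once \<open>N \<ge> i\<close>.\<close>
  define a where "a i N = (if i \<le> N then level_ratio N i else 0)" for i N
  have "(\<lambda>N. \<Sum>i. a i N) \<longlonglongrightarrow> (\<Sum>i. 1 / fact i)"
  proof (rule tannerys_theorem[THEN conjunct2, THEN conjunct2])
    show "(\<lambda>N. a i N) \<longlonglongrightarrow> 1 / fact i" for i
      using level_ratio_tendsto
    proof (rule Lim_transform_eventually)
      show "\<forall>\<^sub>F N in sequentially. level_ratio N i = a i N"
        using eventually_ge_at_top[of i] by eventually_elim (simp add: a_def)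
    qed
    show "\<forall>\<^sub>F (i, N) in at_top \<times>\<^sub>F sequentially. norm (a i N) \<le> 3 / 2 * (2 / 3) ^ i"
      using level_ratio_le level_ratio_nonneg
      by (intro always_eventually) (auto simp: a_def simp del: times_divide_eq_left)
    show "summable (\<lambda>i. 3 / 2 * (2 / 3 :: real) ^ i)"
      by (intro summable_mult summable_geometric) simp
  qed simp
  moreover have "(\<Sum>i. 1 / fact i) = exp (1 :: real)"
    by (simp add: exp_def divide_inverse)
  moreover have "(\<Sum>i. a i N) = mean_Sem_size (Suc N) / (fact (Suc N) / 2 ^ N)" for N
  proof -
    have "(\<Sum>i. a i N) = (\<Sum>i\<le>N. level_ratio N i)"
      by (subst suminf_finite[of "{..N}"]) (auto simp: a_def)
    moreover have "mean_Sem_size (Suc N) = (\<Sum>i\<le>N. level_ratio N i) * (fact (Suc N) / 2 ^ N)"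
      unfolding sum_distrib_right by (simp add: mean_Sem_size_eq mean_Sem_level_ratio)
    ultimately show ?thesis by (simp del: fact_Suc)
  qed
  ultimately show ?thesis by simp
qed

theorem theorem26:
  shows "(\<forall>n\<ge>1. mean_Sem_size n = (\<Sum>i=0..n-1. mean_Sem_level n i)) \<and>
         mean_Sem_size \<sim>[sequentially] (\<lambda>n. exp 1 * fact n / 2 ^ (n - 1))"
proof
  show "\<forall>n\<ge>1. mean_Sem_size n = (\<Sum>i=0..n-1. mean_Sem_level n i)"
  proof (intro allI impI)
    fix n :: nat assume "1 \<le> n"
    then obtain N where "n = Suc N" by (cases n) auto
    then show "mean_Sem_size n = (\<Sum>i=0..n-1. mean_Sem_level n i)"
      by (simp add: mean_Sem_size_eq atMost_atLeast0)
  qed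
  have "(\<lambda>N. mean_Sem_size (Suc N) / (fact (Suc N) / 2 ^ N) / exp 1) \<longlonglongrightarrow> exp 1 / exp 1"
    by (intro tendsto_divide mean_Sem_size_normalised_tendsto tendsto_const) simp
  then have "(\<lambda>N. mean_Sem_size (Suc N) / (exp 1 * fact (Suc N) / 2 ^ (Suc N - 1))) \<longlonglongrightarrow> 1"
    by (simp add: mult_ac del: fact_Suc)
  \<comment> \<open>Passing from \<open>Suc N\<close> back to \<open>n\<close> only adds the value
    at \<open>n = 0\<close>, which does not affect the limit.\<close>
  then have "(\<lambda>n. mean_Sem_size n / (exp 1 * fact n / 2 ^ (n - 1))) \<longlonglongrightarrow> 1"
    by (rule LIMSEQ_imp_Suc)
  then show "mean_Sem_size \<sim>[sequentially] (\<lambda>n. exp 1 * fact n / 2 ^ (n - 1))"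
    by (rule asymp_equivI')
qed

end
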